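(* Let $d>1$, let $\prec$ be a term order on $\mathbb{N}^d$, and let $S\subseteq\mathbb{N}^d$ be a $\mathcal{C}$-semigroup such that $\mathrm{cone}(S)\cap\mathbb{N}^d=\mathbb{N}^d$. If $S$ is $\prec$-symmetric or $\prec$-pseudo-symmetric, then $S$ satisfies the extended Wilf's conjecture, i.e. $$|\{g\in S\mid g\prec F(S)_\prec\}|\cdot e(S)\ \ge\ \mathcal{N}(F(S)_\prec)+1,$$ where $\mathcal{N}(F(S)_\prec)=|\mathcal{H}(S)|+|\{g\in S\mid g\prec F(S)_\prec\}|$ and $e(S)$ is the embedding dimension of $S$.
   Context: $\mathbb{N}$ denotes the non-negative integers. An affine semigroup $S$ is a finitely generated submonoid of $\mathbb{N}^d$; it has a unique minimal generating set $\{a_1,\dots,a_n\}$, whose cardinality $n=e(S)$ is the embedding dimension. Put $\mathrm{cone}(S)=\{\sum_{i=1}^n\lambda_i a_i\mid \lambda_i\in\mathbb{Q}_{\ge 0}\}$ and $\mathcal{H}(S)=(\mathrm{cone}(S)\setminus S)\cap\mathbb{N}^d$. The set of pseudo-Frobenius elements is $\mathrm{PF}(S)=\{f\in\mathcal{H}(S)\mid f+s\in S \text{ for all } s\in S\setminus\{0\}\}$. $S$ is an MPD-semigroup if $\mathrm{PF}(S)\neq\emptyset$. $S$ is a $\mathcal{C}$-semigroup if it is an MPD-semigroup and $\mathcal{H}(S)$ is non-empty and finite. A term order (monomial ordering) on $\mathbb{N}^d$ is a total order $\prec$ compatible with addition and with $0\prec a$ for all $a\neq 0$. The Frobenius element with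 respect to $\prec$ is $F(S)_\prec=\max_\prec\mathcal{H}(S)$ (if it exists; it does when $\mathcal{H}(S)$ is finite and non-empty). $S$ is $\prec$-symmetric if $F(S)_\prec$ exists and $\mathrm{PF}(S)=\{F(S)_\prec\}$. Put $\mathrm{PF}'_\prec(S)=\mathrm{PF}(S)\setminus\{F(S)_\prec\}$. $S$ is $\prec$-almost symmetric if $F(S)_\prec$ exists, $\mathrm{PF}'_\prec(S)\neq\emptyset$, and $F(S)_\prec-g\in\mathrm{PF}'_\prec(S)$ for every $g\in\mathrm{PF}'_\prec(S)$. $S$ is $\prec$-pseudo-symmetric if it is $\prec$-almost symmetric and $|\mathrm{PF}(S)|=2$; in this case $\mathrm{PF}(S)=\{F(S)_\prec,F(S)_\prec/2\}$. Cardinalities are taken in $\mathbb{N}\cup\{\infty\}$ (for some term orders the set $\{g\in S\mid g\prec F(S)_\prec\}$ may be infinite). *)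

theory Defs
  imports "HOL-Analysis.Finite_Cartesian_Product" "HOL-Library.Extended_Nat"
begin

definition is_submonoid :: "(nat ^ 'd) set \<Rightarrow> bool" where
  "is_submonoid S \<longleftrightarrow> 0 \<in> S \<and> (\<forall>x\<in>S. \<forall>y\<in>S. x + y \<in> S)"

definition affine_semigroup :: "(nat ^ 'd) set \<Rightarrow> bool" where
  "affine_semigroup S \<longleftrightarrow> is_submonoid S \<and> (\<exists>A. finite A \<and> is_submonoid hull A = S)"

definition is_minimal_generating_set :: "(nat ^ 'd) set \<Rightarrow> (nat ^ 'd) set \<Rightarrow> bool" where
  "is_minimal_generating_set S A \<longleftrightarrow>
     is_submonoid hull A = S \<and> (\<forall>B. B \<subset> A \<longrightarrow> is_submonoid hull B \<noteq> S)"

definition minimal_generating_set :: "(nat ^ 'd) set \<Rightarrow> (nat ^ 'd) set" where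
  "minimal_generating_set S = (THE A. is_minimal_generating_set S A)"

text \<open>Cardinality with values in \<open>\<nat> \<union> {\<infinity>}\<close>; note that \<^const>\<open>card\<close> is 0 on infinite sets.\<close>

definition ecard :: "'a set \<Rightarrow> enat" where
  "ecard A = (if finite A then enat (card A) else \<infinity>)"

definition embedding_dim :: "(nat ^ 'd) set \<Rightarrow> enat" where
  "embedding_dim S = ecard (minimal_generating_set S)"

definition rat_vec :: "nat ^ 'd \<Rightarrow> rat ^ 'd" where
  "rat_vec x = (\<chi> i. of_nat (x $ i))"

definition rational_cone :: "(nat ^ 'd) set \<Rightarrow> (rat ^ 'd) set" where
  "rational_cone S = {\<Sum>a\<in>minimal_generating_set S. c a *s rat_vec a | c.
               \<forall>a\<in>minimal_generating_set S. c a \<ge> 0}"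

definition gaps :: "(nat ^ 'd) set \<Rightarrow> (nat ^ 'd) set" where
  "gaps S = {x. rat_vec x \<in> rational_cone S \<and> x \<notin> S}"

definition PF :: "(nat ^ 'd) set \<Rightarrow> (nat ^ 'd) set" where
  "PF S = {f \<in> gaps S. \<forall>s\<in>S - {0}. f + s \<in> S}"

definition MPD_semigroup :: "(nat ^ 'd) set \<Rightarrow> bool" where
  "MPD_semigroup S \<longleftrightarrow> affine_semigroup S \<and> PF S \<noteq> {}"

definition C_semigroup :: "(nat ^ 'd) set \<Rightarrow> bool" where
  "C_semigroup S \<longleftrightarrow> MPD_semigroup S \<and> gaps S \<noteq> {} \<and> finite (gaps S)"

definition term_order :: "(nat ^ 'd \<Rightarrow> nat ^ 'd \<Rightarrow> bool) \<Rightarrow> bool" where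
  "term_order lt \<longleftrightarrow> irreflp lt \<and> transp lt \<and> totalp lt \<and>
     (\<forall>a b c. lt a b \<longrightarrow> lt (a + c) (b + c)) \<and> (\<forall>a. a \<noteq> 0 \<longrightarrow> lt 0 a)"

definition is_Frobenius ::
  "(nat ^ 'd \<Rightarrow> nat ^ 'd \<Rightarrow> bool) \<Rightarrow> (nat ^ 'd) set \<Rightarrow> nat ^ 'd \<Rightarrow> bool" where
  "is_Frobenius lt S f \<longleftrightarrow> f \<in> gaps S \<and> (\<forall>h\<in>gaps S. h \<noteq> f \<longrightarrow> lt h f)"

definition Frobenius ::
  "(nat ^ 'd \<Rightarrow> nat ^ 'd \<Rightarrow> bool) \<Rightarrow> (nat ^ 'd) set \<Rightarrow> nat ^ 'd" where
  "Frobenius lt S = (THE f. is_Frobenius lt S f)"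

definition symmetric_semigroup ::
  "(nat ^ 'd \<Rightarrow> nat ^ 'd \<Rightarrow> bool) \<Rightarrow> (nat ^ 'd) set \<Rightarrow> bool" where
  "symmetric_semigroup lt S \<longleftrightarrow>
     (\<exists>f. is_Frobenius lt S f) \<and> PF S = {Frobenius lt S}"

definition PF' ::
  "(nat ^ 'd \<Rightarrow> nat ^ 'd \<Rightarrow> bool) \<Rightarrow> (nat ^ 'd) set \<Rightarrow> (nat ^ 'd) set" where
  "PF' lt S = PF S - {Frobenius lt S}"

text \<open>The difference of the Frobenius element and \<open>g\<close> is taken in \<open>\<int>\<^sup>d\<close>. Since subtraction on
  \<^typ>\<open>nat\<close> truncates, membership of the difference in \<^const>\<open>PF'\<close> is expressed additively.\<close>

definition almost_symmetric ::
  "(nat ^ 'd \<Rightarrow> nat ^ 'd \<Rightarrow> bool) \<Rightarrow> (nat ^ 'd) set \<Rightarrow> bool" where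
  "almost_symmetric lt S \<longleftrightarrow>
     (\<exists>f. is_Frobenius lt S f) \<and> PF' lt S \<noteq> {} \<and>
     (\<forall>g\<in>PF' lt S. \<exists>h\<in>PF' lt S. Frobenius lt S = h + g)"

definition pseudo_symmetric ::
  "(nat ^ 'd \<Rightarrow> nat ^ 'd \<Rightarrow> bool) \<Rightarrow> (nat ^ 'd) set \<Rightarrow> bool" where
  "pseudo_symmetric lt S \<longleftrightarrow> almost_symmetric lt S \<and> card (PF S) = 2"

definition elements_below_Frobenius ::
  "(nat ^ 'd \<Rightarrow> nat ^ 'd \<Rightarrow> bool) \<Rightarrow> (nat ^ 'd) set \<Rightarrow> (nat ^ 'd) set" where
  "elements_below_Frobenius lt S = {g \<in> S. lt g (Frobenius lt S)}"

definition N_Frobenius ::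
  "(nat ^ 'd \<Rightarrow> nat ^ 'd \<Rightarrow> bool) \<Rightarrow> (nat ^ 'd) set \<Rightarrow> enat" where
  "N_Frobenius lt S = ecard (gaps S) + ecard (elements_below_Frobenius lt S)"

definition extended_Wilf ::
  "(nat ^ 'd \<Rightarrow> nat ^ 'd \<Rightarrow> bool) \<Rightarrow> (nat ^ 'd) set \<Rightarrow> bool" where
  "extended_Wilf lt S \<longleftrightarrow>
     ecard (elements_below_Frobenius lt S) * embedding_dim S \<ge> N_Frobenius lt S + 1"

text \<open>The two definite descriptions above denote: every submonoid of \<open>\<nat>\<^sup>d\<close> has exactly one minimal
  generating set, and Frobenius elements with respect to a term order are unique.\<close>

lemma is_submonoid_hull: "is_submonoid (is_submonoid hull A)"
  by (rule hull_in) (auto simp: is_submonoid_def)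

lemma ex1_minimal_generating_set:
  fixes S :: "(nat ^ 'd) set"
  assumes S: "is_submonoid S"
  shows "\<exists>!A. is_minimal_generating_set S A"
proof -
  define B where "B = {x \<in> S - {0}. \<forall>y\<in>S - {0}. \<forall>z\<in>S - {0}. x \<noteq> y + z}"
  define w where "w = (\<lambda>x :: nat ^ 'd. \<Sum>i\<in>UNIV. x $ i)"
  have w_add: "w (x + y) = w x + w y" for x y
    by (simp add: w_def sum.distrib)
  have w_pos: "w x > 0" if "x \<noteq> 0" for x
    using that by (auto simp: w_def vec_eq_iff intro!: sum_pos2)
  have le: "B \<subseteq> A" if A: "is_submonoid hull A = S" for A
  proof -
    let ?M = "{x \<in> S. x \<notin> B \<or> x \<in> A}"
    have "is_submonoid ?M"
      unfolding is_submonoid_def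
    proof (intro conjI ballI)
      show "0 \<in> ?M" using S by (auto simp: is_submonoid_def B_def)
    next
      fix x y assume xy: "x \<in> ?M" "y \<in> ?M"
      show "x + y \<in> ?M"
      proof (cases "x = 0 \<or> y = 0")
        case True
        then show ?thesis using xy by auto
      next
        case False
        then have "x + y \<notin> B" using xy unfolding B_def by blast
        then show ?thesis using xy S by (auto simp: is_submonoid_def)
      qed
    qed
    moreover have "A \<subseteq> ?M" using A hull_subset[of A is_submonoid] by auto
    ultimately have "is_submonoid hull A \<subseteq> ?M" by (intro hull_minimal)
    then show ?thesis using A by (auto simp: B_def)
  qed
  have "x \<in> is_submonoid hull B" if "x \<in> S" for x
    using that
  proof (induction "w x" arbitrary: x rule: less_induct)
    case less
    have hullB: "0 \<in> is_submonoid hull B"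
      "\<And>x y. x \<in> is_submonoid hull B \<Longrightarrow> y \<in> is_submonoid hull B \<Longrightarrow> x + y \<in> is_submonoid hull B"
      using is_submonoid_hull[of B] unfolding is_submonoid_def[of "is_submonoid hull B"] by auto
    consider "x = 0" | "x \<in> B"
      | y z where "y \<in> S" "z \<in> S" "y \<noteq> 0" "z \<noteq> 0" "x = y + z"
      using less.prems unfolding B_def by blast
    then show ?case
    proof cases
      case 3
      then have "w y < w x" "w z < w x" using w_add w_pos by auto
      then show ?thesis using 3 less.hyps hullB by auto
    qed (use hullB hull_inc[of x B] in auto)
  qed
  moreover have "is_submonoid hull B \<subseteq> S"
    using S by (intro hull_minimal) (auto simp: B_def)
  ultimately have gen: "is_submonoid hull B = S" by blast
  show ?thesis
  proof (rule ex1I)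
    show "is_minimal_generating_set S B"
      unfolding is_minimal_generating_set_def using gen le by blast
  next
    fix A assume "is_minimal_generating_set S A"
    then show "A = B"
      unfolding is_minimal_generating_set_def using gen le[of A] by blast
  qed
qed

lemma Frobenius_eqI:
  assumes "term_order lt" "is_Frobenius lt S f"
  shows "Frobenius lt S = f"
  unfolding Frobenius_def
proof (rule the_equality)
  fix g assume "is_Frobenius lt S g"
  then show "g = f"
    using assms unfolding is_Frobenius_def term_order_def
    by (metis irreflpD transpD)
qed (rule assms(2))

end

theory Submission
  imports Defs
begin

text \<open>Let \<open>L\<close> be the set of elements of \<open>S\<close> below the Frobenius element \<open>F\<close>. Every gap lies below a
  pseudo-Frobenius element. Hence \<open>x \<mapsto> F - x\<close> maps the gaps injectively into \<open>L\<close>, with the exception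
  of \<open>x = F/2\<close> in the pseudo-symmetric case, and the number of gaps is at most \<open>|L| + 1\<close>. Since
  \<open>0 \<in> L\<close>, the inequality follows from \<open>e(S) \<ge> 4\<close>. For the latter choose a coordinate \<open>j\<close> whose unit
  vector is a gap. Since \<open>S\<close> is cofinite, every generating set contains two elements on the \<open>j\<close>-th
  axis, a nonzero element with \<open>j\<close>-th coordinate 0 and an element with \<open>j\<close>-th coordinate 1.\<close>

text \<open>Forces generators of a prescribed shape to exist: if all of \<open>A\<close> satisfied
  \<open>P\<close>, the submonoid cut out by \<open>P\<close> would contain the hull and with it
  \<open>x\<close>.\<close>

lemma generator_outside_submonoid:
  assumes "x \<in> is_submonoid hull A" "\<not> P x" "P 0"
    and "\<And>y z. P y \<Longrightarrow> P z \<Longrightarrow> P (y + z)"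
  obtains a where "a \<in> A" "\<not> P a"
proof -
  have "is_submonoid {x. P x}"
    using assms(3,4) by (auto simp: is_submonoid_def)
  then have "\<not> A \<subseteq> {x. P x}"
    using assms(1,2) hull_minimal[of A "{x. P x}" is_submonoid] by blast
  then show thesis using that by auto
qed

lemma cofinite_meets_range:
  fixes f :: "nat \<Rightarrow> 'a"
  assumes "finite (- S)" "inj f"
  obtains n where "f n \<in> S"
proof -
  have "\<not> range f \<subseteq> - S"
    using assms by (meson finite_subset range_inj_infinite)
  then show thesis using that by auto
qed

lemma axis_nth_other: "k \<noteq> j \<Longrightarrow> axis j n $ k = (0 :: nat)"
  by (simp add: axis_def)

lemma axis_nth_same: "axis j n $ j = (n :: nat)"
  by (simp add: axis_def)

lemma axis_add: "axis j (m + n) = axis j m + axis j (n :: nat)"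
  by (simp add: vec_eq_iff axis_def)

lemma eq_UNIV_if_axes:
  fixes S :: "(nat ^ 'd) set"
  assumes S: "is_submonoid S" and ax: "\<And>j. axis j 1 \<in> S"
  shows "S = UNIV"
proof -
  have axis: "axis j n \<in> S" for j n
  proof (induction n)
    case 0
    have "axis j 0 = (0 :: nat ^ 'd)" by (simp add: vec_eq_iff axis_def)
    then show ?case using S by (metis is_submonoid_def)
  next
    case (Suc n)
    then show ?case using S ax[of j] axis_add[of j n 1] by (simp add: is_submonoid_def)
  qed
  have "(\<Sum>j\<in>J. axis j (x $ j)) \<in> S" if "finite J" for x :: "nat ^ 'd" and J
    using that S axis by (induction J) (auto simp: is_submonoid_def)
  moreover have "(\<Sum>j\<in>UNIV. axis j (x $ j)) = x" for x :: "nat ^ 'd"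
    by (simp add: vec_eq_iff axis_def if_distrib cong: if_cong)
  ultimately show ?thesis by (metis UNIV_eq_I finite)
qed

text \<open>Coordinates are non-negative, so a sum lies on the \<open>j\<close>-th axis only if both
  summands do. Hence the vectors that are off this axis or have \<open>j\<close>-th coordinate
  divisible by \<open>m\<close> form a submonoid, and a cofinite hull is not contained in
  it.\<close>

lemma axis_generator:
  fixes A :: "(nat ^ 'd) set"
  assumes "finite (- (is_submonoid hull A))" "m \<noteq> 1"
  obtains a where "a \<in> A" "\<forall>k. k \<noteq> j \<longrightarrow> a $ k = 0" "\<not> m dvd a $ j"
proof -
  define P where "P = (\<lambda>x :: nat ^ 'd. (\<forall>k. k \<noteq> j \<longrightarrow> x $ k = 0) \<longrightarrow> m dvd x $ j)"
  \<comment> \<open>For \<open>m = 0\<close> the points with coordinate \<open>m * n + 1\<close>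
    would all coincide, and non-divisibility just means being nonzero.\<close>
  have "inj (\<lambda>n. axis j (if m = 0 then Suc n else m * n + 1) :: nat ^ 'd)"
  proof (rule injI)
    fix x y
    assume "(axis j (if m = 0 then Suc x else m * x + 1) :: nat ^ 'd)
          = axis j (if m = 0 then Suc y else m * y + 1)"
    then show "x = y" by (cases "m = 0") (auto dest!: arg_cong[where f = "\<lambda>v. v $ j"] simp: axis_nth_same)
  qed
  with assms(1) obtain n where
    n: "axis j (if m = 0 then Suc n else m * n + 1) \<in> is_submonoid hull A"
    by (rule cofinite_meets_range)
  have "\<not> m dvd m * n + 1" using assms(2) by (metis dvd_add_right_iff dvd_triv_left nat_dvd_1_iff_1)
  then have "\<not> P (axis j (if m = 0 then Suc n else m * n + 1))"
    by (auto simp: P_def axis_nth_other axis_nth_same)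
  with n obtain a where "a \<in> A" "\<not> P a"
    by (rule generator_outside_submonoid) (auto simp: P_def)
  then show thesis using that by (auto simp: P_def)
qed

lemma four_le_card_generators:
  fixes A :: "(nat ^ 'd) set"
  assumes d: "CARD('d) > 1"
    and fin: "finite (- (is_submonoid hull A))" and proper: "is_submonoid hull A \<noteq> UNIV"
    and "finite A"
  shows "4 \<le> card A"
proof -
  let ?S = "is_submonoid hull A"
  obtain j where j: "axis j 1 \<notin> ?S"
    using eq_UNIV_if_axes[OF is_submonoid_hull] proper by blast
  have "UNIV \<noteq> {j}" using d by (metis card_1_singleton_iff less_irrefl One_nat_def)
  then obtain i where i: "i \<noteq> j" by blast
  have not_unit: "a $ j \<noteq> 1" if "a \<in> A" "\<forall>k. k \<noteq> j \<longrightarrow> a $ k = 0" for a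
  proof
    assume "a $ j = 1"
    with that(2) have "a = axis j 1" by (simp add: vec_eq_iff axis_def)
    then show False using j that(1) hull_inc[of a A is_submonoid] by auto
  qed
  obtain a where a: "a \<in> A" "\<forall>k. k \<noteq> j \<longrightarrow> a $ k = 0" "\<not> 0 dvd a $ j"
    using fin by (rule axis_generator[where m = 0]) auto
  \<comment> \<open>The modulus is \<open>a $ j\<close>, which differs from 1 because the unit
    vector is a gap. So \<open>b\<close> is a nonzero vector on the same axis and not a multiple of
    \<open>a\<close>.\<close>
  obtain b where b: "b \<in> A" "\<forall>k. k \<noteq> j \<longrightarrow> b $ k = 0" "\<not> a $ j dvd b $ j"
    using fin not_unit[OF a(1,2)] by (rule axis_generator)
  obtain c where c: "c \<in> A" "\<forall>k. k \<noteq> i \<longrightarrow> c $ k = 0" "\<not> 0 dvd c $ i"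
    using fin by (rule axis_generator[where m = 0]) auto
  have "inj (\<lambda>n. axis i n + axis j 1 :: nat ^ 'd)"
    by (rule injI) (metis add_right_cancel axis_nth_same)
  with fin obtain n where "axis i n + axis j 1 \<in> ?S"
    by (rule cofinite_meets_range)
  moreover have "\<not> (axis i n + axis j 1 :: nat ^ 'd) $ j \<noteq> 1"
    using i by (simp add: axis_def)
  ultimately obtain e where e: "e \<in> A" "\<not> e $ j \<noteq> 1"
    by (rule generator_outside_submonoid[where P = "\<lambda>x. x $ j \<noteq> 1"]) (auto simp: add_is_1)
  \<comment> \<open>The \<open>j\<close>-th coordinate is 0 for \<open>c\<close>, 1 for
    \<open>e\<close>, and neither for \<open>a\<close> and \<open>b\<close>.\<close>
  have "b $ j \<noteq> 0" using b(3) by (metis dvd_0_right)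
  then have "a \<noteq> b" "a \<noteq> c" "b \<noteq> c" "a \<noteq> e" "b \<noteq> e" "c \<noteq> e"
    using a b c e i not_unit[OF a(1,2)] not_unit[OF b(1,2)] by auto
  then have "card {a, b, c, e} = 4" by simp
  then show ?thesis
    using card_mono[OF \<open>finite A\<close>, of "{a, b, c, e}"] a b c e by simp
qed

lemma term_order_less_add:
  assumes "term_order lt" "x \<noteq> 0"
  shows "lt s (x + s)"
  using assms unfolding term_order_def by (metis add_0_left)

lemma Frobenius_in_PF:
  assumes lt: "term_order lt" and F: "is_Frobenius lt S F"
    and gaps: "gaps S = - S"
  shows "F \<in> PF S"
proof -
  have "F + s \<in> S" if "s \<in> S - {0}" for s
  proof (rule ccontr)
    assume "F + s \<notin> S"
    moreover have *: "lt F (F + s)"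
      using term_order_less_add[OF lt, of s F] that by (simp add: add.commute)
    ultimately have "lt (F + s) F"
      using F gaps that by (auto simp: is_Frobenius_def)
    then show False using * lt unfolding term_order_def by (meson irreflpD transpD)
  qed
  then show ?thesis using F by (auto simp: PF_def is_Frobenius_def)
qed

text \<open>Among the finitely many gaps in \<open>x + S\<close> take a maximal one with respect to
  \<open>lt\<close>. Adding a nonzero element of \<open>S\<close> stays in \<open>x + S\<close> and
  goes up, so it must leave the gaps.\<close>

lemma gap_le_PF:
  fixes S :: "(nat ^ 'd) set" and lt :: "nat ^ 'd \<Rightarrow> nat ^ 'd \<Rightarrow> bool"
  assumes lt: "term_order lt" and S: "is_submonoid S"
    and gaps: "gaps S = - S" and fin: "finite (- S)" and x: "x \<notin> S"
  obtains s where "s \<in> S" "x + s \<in> PF S"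
proof -
  define G where "G = {y. y \<notin> S \<and> (\<exists>s\<in>S. y = x + s)}"
  have "finite G" using fin by (rule rev_finite_subset) (auto simp: G_def)
  moreover have "x \<in> G" using x S by (force simp: G_def is_submonoid_def)
  moreover have "transp lt" "asymp lt"
    using lt unfolding term_order_def by (auto intro: asympI dest: irreflpD transpD)
  ultimately obtain f where f: "f \<in> G" "\<And>y. y \<in> G \<Longrightarrow> y \<noteq> f \<Longrightarrow> \<not> lt f y"
    using Finite_Set.bex_max_element[of G lt] asymp_on_subset[of UNIV lt G]
      transp_on_subset[of UNIV lt G] by auto
  then obtain s where s: "s \<in> S" "f = x + s" "f \<notin> S" by (auto simp: G_def)
  have "f + t \<in> S" if t: "t \<in> S - {0}" for t
  proof (rule ccontr)
    assume "f + t \<notin> S"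
    then have "f + t \<in> G" using s t S by (auto simp: G_def is_submonoid_def add.assoc)
    moreover have "lt f (f + t)"
      using term_order_less_add[OF lt, of t f] t by (simp add: add.commute)
    ultimately show False using f(2)[of "f + t"] t by auto
  qed
  then show thesis using that s gaps by (auto simp: PF_def)
qed

text \<open>The map \<open>x \<mapsto> F - x\<close> is injective by cancellation, and its values
  are below \<open>F\<close> because a gap is nonzero. The summand 1 pays for the possible
  exceptional gap \<open>h\<close>.\<close>

lemma card_gaps_le:
  assumes lt: "term_order lt" and S: "is_submonoid S"
    and fin: "finite (- S)" "finite {g \<in> S. lt g F}"
    and reflect: "\<And>x. x \<notin> S \<Longrightarrow> x \<noteq> h \<Longrightarrow> \<exists>s\<in>S. F = x + s"
  shows "card (- S) \<le> card {g \<in> S. lt g F} + 1"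
proof -
  obtain r where r: "\<And>x. x \<in> - S - {h} \<Longrightarrow> r x \<in> S \<and> F = x + r x"
    using reflect by (metis ComplD DiffD1 DiffD2 singletonI)
  have "inj_on r (- S - {h})"
    by (rule inj_onI) (metis r add_right_cancel)
  moreover have "r x \<in> {g \<in> S. lt g F}" if x: "x \<in> - S - {h}" for x
  proof -
    have "x \<noteq> 0" using x S by (auto simp: is_submonoid_def)
    then show ?thesis using r[OF x] term_order_less_add[OF lt, of x "r x"] by simp
  qed
  ultimately have "card (- S - {h}) \<le> card {g \<in> S. lt g F}"
    using fin(2) by (intro card_inj_on_le) auto
  then show ?thesis using fin(1) by (cases "h \<in> - S") auto
qed

text \<open>The existential \<open>h\<close> treats both cases at once: it is \<open>F/2\<close> in
  the pseudo-symmetric case and arbitrary in the symmetric one.\<close>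

lemma gap_reflection:
  assumes lt: "term_order lt" and S: "is_submonoid S"
    and gaps: "gaps S = - S" and fin: "finite (- S)"
    and F: "is_Frobenius lt S F"
    and sym: "symmetric_semigroup lt S \<or> pseudo_symmetric lt S"
  shows "\<exists>h. \<forall>x. x \<notin> S \<longrightarrow> x \<noteq> h \<longrightarrow> (\<exists>s\<in>S. F = x + s)"
proof -
  have Feq: "Frobenius lt S = F" by (rule Frobenius_eqI[OF lt F])
  from sym show ?thesis
  proof
    assume "symmetric_semigroup lt S"
    then have "PF S = {F}" by (simp add: symmetric_semigroup_def Feq)
    then show ?thesis using gap_le_PF[OF lt S gaps fin] by (metis singletonD)
  next
    assume ps: "pseudo_symmetric lt S"
    then have "card (PF' lt S) = 1"
      using Frobenius_in_PF[OF lt F gaps] by (simp add: pseudo_symmetric_def PF'_def Feq)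
    then obtain h where h: "PF' lt S = {h}" by (auto simp: card_1_singleton_iff)
    \<comment> \<open>Almost symmetry pairs each element of \<open>PF' lt S\<close> with another of
      the same set, so the only element is its own partner.\<close>
    then have Fh: "F = h + h"
      using ps by (simp add: pseudo_symmetric_def almost_symmetric_def Feq)
    have "\<exists>s\<in>S. F = x + s" if x: "x \<notin> S" "x \<noteq> h" for x
    proof -
      obtain s where s: "s \<in> S" "x + s \<in> PF S"
        using gap_le_PF[OF lt S gaps fin x(1)] .
      consider "x + s = F" | "x + s = h" using s(2) h by (auto simp: PF'_def Feq)
      then show ?thesis
      proof cases
        \<comment> \<open>Here \<open>F = x + (s + h)\<close>, and \<open>s + h\<close> lies in
          \<open>S\<close> since \<open>h\<close> is pseudo-Frobenius and \<open>s\<close> is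
          nonzero.\<close>
        case 2
        then have "s + h \<in> S"
        proof -
          have "h \<in> PF S" using h by (auto simp: PF'_def)
          moreover have "s \<noteq> 0" using 2 x(2) by auto
          ultimately show ?thesis using s(1) by (simp add: PF_def add.commute[of s])
        qed
        then show ?thesis using 2 Fh by (metis add.assoc)
      qed (use s(1) in auto)
    qed
    then show ?thesis by blast
  qed
qed

theorem theorem3p12:
  fixes lt :: "nat ^ 'd \<Rightarrow> nat ^ 'd \<Rightarrow> bool"
    and S :: "(nat ^ 'd) set"
  assumes "CARD('d) > 1"
    and "term_order lt"
    and "C_semigroup S"
    and "rational_cone S \<inter> range rat_vec = range rat_vec"
    and "symmetric_semigroup lt S \<or> pseudo_symmetric lt S"
  shows "extended_Wilf lt S"
proof -
  note lt = assms(2)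
  have S: "is_submonoid S"
    using assms(3) by (simp add: C_semigroup_def MPD_semigroup_def affine_semigroup_def)
  have gaps: "gaps S = - S" using assms(4) by (auto simp: gaps_def)
  then have fin: "finite (- S)" and proper: "S \<noteq> UNIV"
    using assms(3) by (auto simp: C_semigroup_def)
  obtain F where F: "is_Frobenius lt S F"
    using assms(5)
    by (auto simp: symmetric_semigroup_def pseudo_symmetric_def almost_symmetric_def)
  let ?A = "minimal_generating_set S" and ?L = "{g \<in> S. lt g F}"
  have L: "elements_below_Frobenius lt S = ?L"
    by (simp add: elements_below_Frobenius_def Frobenius_eqI[OF lt F])
  have "is_submonoid hull ?A = S"
    using theI'[OF ex1_minimal_generating_set[OF S], folded minimal_generating_set_def]
    unfolding is_minimal_generating_set_def by (rule conjunct1)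
  then have e: "finite ?A \<Longrightarrow> 4 \<le> card ?A"
    using four_le_card_generators[OF assms(1), of ?A] fin proper by simp
  have "F \<noteq> 0" using F S gaps by (auto simp: is_Frobenius_def is_submonoid_def)
  then have "0 \<in> ?L" using S lt by (simp add: is_submonoid_def term_order_def)
  show ?thesis
  proof (cases "finite ?L \<and> finite ?A")
    case True
    then have "card ?L \<ge> 1" using \<open>0 \<in> ?L\<close> by (auto simp: Suc_le_eq card_gt_0_iff)
    moreover have "card (- S) \<le> card ?L + 1"
    proof -
      obtain h where "\<And>x. x \<notin> S \<Longrightarrow> x \<noteq> h \<Longrightarrow> \<exists>s\<in>S. F = x + s"
        using gap_reflection[OF lt S gaps fin F assms(5)] by blast
      then show ?thesis using True by (intro card_gaps_le[OF lt S fin]) auto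
    qed
    moreover have "card ?L * 4 \<le> card ?L * card ?A" using e True by simp
    \<comment> \<open>With \<open>l = card ?L\<close>, the left side is at most
      \<open>2 * l + 2\<close>, which is at most \<open>4 * l\<close> since \<open>l\<close> is at
      least 1.\<close>
    ultimately have "card (- S) + card ?L + 1 \<le> card ?L * card ?A" by linarith
    then show ?thesis using True fin
      by (simp add: extended_Wilf_def N_Frobenius_def embedding_dim_def L gaps ecard_def one_enat_def)
  next
    case False
    \<comment> \<open>One factor is infinite and neither vanishes, so the product is infinite and
      bounds anything.\<close>
    have "ecard ?L \<noteq> 0" "ecard ?A \<noteq> 0"
      using \<open>0 \<in> ?L\<close> e by (auto simp: ecard_def zero_enat_def)
    then have "ecard ?L * ecard ?A = \<infinity>"
      using False by (auto simp: ecard_def imult_is_infinity)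
    then show ?thesis by (simp add: extended_Wilf_def embedding_dim_def L)
  qed
qed

end
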